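(* There are a graph $G=(V,E)$, an integer $k>1$, and weights $w,z\in\mathbb{Z}_+^V$ such that $$\vartheta_k(G,w+z)>\vartheta_k(G,w)+\vartheta_k(G,z).$$
   Context: Graphs are finite and simple; $A_G$ is the adjacency matrix of $G=(V,E)$ and $\mathbb{Z}_+$ is the set of nonnegative integers. For $w\in\mathbb{R}_+^V$, let $\sqrt{w}$ be the entrywise square root and $W=\sqrt{w}\,\sqrt{w}^{\top}$. For an integer $k$ with $1\le k\le|V|$, $$\vartheta_k(G,w)=\max\{\langle W,X\rangle : X\text{ real symmetric }V\times V,\ \langle I,X\rangle=k,\ A_G\circ X=0,\ 0\preceq X\preceq I\},$$ where $I$ is the identity, $\circ$ the entrywise product, $\langle A,B\rangle=\operatorname{trace}(AB)$, and $A\preceq B$ means $B-A$ is positive semidefinite. The integer $k$ in the claim is understood to satisfy $k\le|V|$, so that these quantities are defined. *)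

theory Defs
  imports
    "HOL-Analysis.Function_Topology"
    "Jordan_Normal_Form.Matrix"
begin

text \<open>
  The vertex set of a graph with \<open>n\<close> vertices is \<open>{..<n}\<close>, so that matrices and vectors indexed by
  vertices are those of dimension \<open>n\<close>.
\<close>

definition simple_graph :: "nat \<Rightarrow> nat set set \<Rightarrow> bool" where
  "simple_graph n E \<longleftrightarrow> (\<forall>e\<in>E. e \<subseteq> {..<n} \<and> card e = 2)"

definition adjacency_mat :: "nat \<Rightarrow> nat set set \<Rightarrow> real mat" where
  "adjacency_mat n E = mat n n (\<lambda>(i, j). if {i, j} \<in> E then 1 else 0)"

definition hadamard_prod :: "'a :: times mat \<Rightarrow> 'a mat \<Rightarrow> 'a mat" where
  "hadamard_prod A B = mat (dim_row A) (dim_col A) (\<lambda>ij. A $$ ij * B $$ ij)"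

definition trace :: "'a :: comm_monoid_add mat \<Rightarrow> 'a" where
  "trace A = (\<Sum>i<dim_row A. A $$ (i, i))"

definition trace_inner :: "'a :: semiring_0 mat \<Rightarrow> 'a mat \<Rightarrow> 'a" where
  "trace_inner A B = trace (A * B)"

definition psd :: "nat \<Rightarrow> real mat \<Rightarrow> bool" where
  "psd n A \<longleftrightarrow> A \<in> carrier_mat n n \<and> transpose_mat A = A \<and>
     (\<forall>v\<in>carrier_vec n. 0 \<le> v \<bullet> (A *\<^sub>v v))"

text \<open>The Loewner order; the order \<open>\<le>\<close> that the library puts on matrices is the entrywise one.\<close>

definition loewner_le :: "nat \<Rightarrow> real mat \<Rightarrow> real mat \<Rightarrow> bool" where
  "loewner_le n A B \<longleftrightarrow> psd n (B - A)"

definition weight_mat :: "real vec \<Rightarrow> real mat" where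
  "weight_mat w = mat (dim_vec w) (dim_vec w) (\<lambda>(i, j). sqrt (w $ i) * sqrt (w $ j))"

definition theta_feasible :: "nat \<Rightarrow> nat set set \<Rightarrow> nat \<Rightarrow> real mat set" where
  "theta_feasible n E k =
     {X \<in> carrier_mat n n. transpose_mat X = X \<and>
        trace_inner (1\<^sub>m n) X = real k \<and>
        hadamard_prod (adjacency_mat n E) X = 0\<^sub>m n n \<and>
        loewner_le n (0\<^sub>m n n) X \<and> loewner_le n X (1\<^sub>m n)}"

definition vartheta :: "nat \<Rightarrow> nat set set \<Rightarrow> nat \<Rightarrow> real vec \<Rightarrow> real" where
  "vartheta n E k w =
     (GREATEST r. \<exists>X\<in>theta_feasible n E k. r = trace_inner (weight_mat w) X)"

text \<open>
  \<open>GREATEST\<close> is unspecified where there is no maximum. The rest of the theory shows that the maximum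
  is attained for \<open>1 \<le> k \<le> n\<close>.
\<close>

lemma trace_inner_mat:
  assumes "A \<in> carrier_mat n n"
  shows "trace_inner A (mat n n f) = (\<Sum>i<n. \<Sum>j<n. A $$ (i, j) * f (j, i))"
  using assms unfolding trace_inner_def trace_def
  by (auto simp: scalar_prod_def atLeast0LessThan intro!: sum.cong)

lemma quad_form_mat:
  assumes "v \<in> carrier_vec n"
  shows "v \<bullet> (mat n n f *\<^sub>v v) = (\<Sum>i<n. \<Sum>j<n. v $ i * (f (i, j) * v $ j) :: real)"
  using assms
  by (auto simp: scalar_prod_def atLeast0LessThan sum_distrib_left intro!: sum.cong)

lemma psd_mat_iff:
  "psd n (mat n n f) \<longleftrightarrow> (\<forall>i<n. \<forall>j<n. f (i, j) = f (j, i)) \<and>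
     (\<forall>v. 0 \<le> (\<Sum>i<n. \<Sum>j<n. v i * (f (i, j) * v j)))"
proof -
  have "(\<forall>v\<in>carrier_vec n. 0 \<le> v \<bullet> (mat n n f *\<^sub>v v)) \<longleftrightarrow>
      (\<forall>v. 0 \<le> (\<Sum>i<n. \<Sum>j<n. v i * (f (i, j) * v j)))"
  proof safe
    fix v :: "nat \<Rightarrow> real"
    assume "\<forall>v\<in>carrier_vec n. 0 \<le> v \<bullet> (mat n n f *\<^sub>v v)"
    then have "0 \<le> vec n v \<bullet> (mat n n f *\<^sub>v vec n v)" by simp
    then show "0 \<le> (\<Sum>i<n. \<Sum>j<n. v i * (f (i, j) * v j))"
      by (subst (asm) quad_form_mat) auto
  next
    fix v :: "real vec"
    assume "\<forall>v. 0 \<le> (\<Sum>i<n. \<Sum>j<n. v i * (f (i, j) * v j))" and "v \<in> carrier_vec n"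
    then show "0 \<le> v \<bullet> (mat n n f *\<^sub>v v)"
      by (subst quad_form_mat) auto
  qed
  moreover have "transpose_mat (mat n n f) = mat n n f \<longleftrightarrow> (\<forall>i<n. \<forall>j<n. f (i, j) = f (j, i))"
    by (auto simp: mat_eq_iff)
  ultimately show ?thesis unfolding psd_def by simp
qed

lemma theta_feasible_mat_iff:
  "mat n n f \<in> theta_feasible n E k \<longleftrightarrow>
     (\<forall>i<n. \<forall>j<n. f (i, j) = f (j, i)) \<and>
     (\<Sum>i<n. f (i, i)) = real k \<and>
     (\<forall>i<n. \<forall>j<n. {i, j} \<in> E \<longrightarrow> f (i, j) = 0) \<and>
     (\<forall>v. 0 \<le> (\<Sum>i<n. \<Sum>j<n. v i * (f (i, j) * v j))) \<and>
     (\<forall>v. (\<Sum>i<n. \<Sum>j<n. v i * (f (i, j) * v j)) \<le> (\<Sum>i<n. v i * v i))"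
proof -
  have tr: "trace_inner (1\<^sub>m n) (mat n n f) = (\<Sum>i<n. f (i, i))"
    by (subst trace_inner_mat[where n = n]) (auto simp: if_distrib[of "\<lambda>x. x * _"] sum.delta' cong: if_cong)
  have had: "hadamard_prod (adjacency_mat n E) (mat n n f) = 0\<^sub>m n n \<longleftrightarrow>
      (\<forall>i<n. \<forall>j<n. {i, j} \<in> E \<longrightarrow> f (i, j) = 0)"
    by (auto simp: hadamard_prod_def adjacency_mat_def mat_eq_iff split: if_splits)
  have m0: "mat n n f - 0\<^sub>m n n = mat n n f" by (auto simp: mat_eq_iff)
  have m1: "1\<^sub>m n - mat n n f = mat n n (\<lambda>(i, j). (if i = j then 1 else 0) - f (i, j))"
    by (auto simp: mat_eq_iff)
  have q: "(\<Sum>i<n. \<Sum>j<n. v i * (((if i = j then 1 else 0) - f (i, j)) * v j)) =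
      (\<Sum>i<n. v i * v i) - (\<Sum>i<n. \<Sum>j<n. v i * (f (i, j) * v j))" for v :: "nat \<Rightarrow> real"
  proof -
    have "(\<Sum>j<n. v i * (((if i = j then 1 else 0) - f (i, j)) * v j)) =
        v i * v i - (\<Sum>j<n. v i * (f (i, j) * v j))" if "i < n" for i
    proof -
      have "(\<Sum>j<n. v i * (((if i = j then 1 else 0) - f (i, j)) * v j)) =
          (\<Sum>j<n. (if i = j then v i * v j else 0) - v i * (f (i, j) * v j))"
        by (intro sum.cong) (auto simp: algebra_simps)
      also have "\<dots> = v i * v i - (\<Sum>j<n. v i * (f (i, j) * v j))"
        using that by (simp add: sum_subtractf)
      finally show ?thesis .
    qed
    then show ?thesis by (simp add: sum_subtractf)
  qed
  have sym: "transpose_mat (mat n n f) = mat n n f \<longleftrightarrow> (\<forall>i<n. \<forall>j<n. f (i, j) = f (j, i))"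
    by (auto simp: mat_eq_iff)
  show ?thesis
    unfolding theta_feasible_def loewner_le_def mem_Collect_eq tr had m0 m1 psd_mat_iff sym
    by (auto simp: q)
qed

lemma theta_feasible_entry_bound:
  assumes "mat n n f \<in> theta_feasible n E k" "i < n" "j < n"
  shows "\<bar>f (i, j)\<bar> \<le> 1"
proof -
  have F: "\<And>i j. i < n \<Longrightarrow> j < n \<Longrightarrow> f (i, j) = f (j, i)"
    "\<And>v. 0 \<le> (\<Sum>i<n. \<Sum>j<n. v i * (f (i, j) * v j))"
    "\<And>v. (\<Sum>i<n. \<Sum>j<n. v i * (f (i, j) * v j)) \<le> (\<Sum>i<n. v i * v i)"
    using assms(1) unfolding theta_feasible_mat_iff by blast+
  define e where "e p = (\<lambda>q. if q = p then 1 else 0 :: real)" for p :: nat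
  have ex: "(\<Sum>p<n. \<Sum>q<n. (a * e i p + b * e j p) * (f (p, q) * (a * e i q + b * e j q))) =
      a * a * f (i, i) + a * b * f (i, j) + b * a * f (j, i) + b * b * f (j, j)" for a b
  proof -
    have inner: "(\<Sum>q<n. g q * (a * e i q + b * e j q)) = a * g i + b * g j" for g :: "nat \<Rightarrow> real"
      using assms(2,3)
      by (simp add: e_def distrib_left sum.distrib if_distrib[of "\<lambda>x. _ * x"] sum.delta cong: if_cong)
    have "(\<Sum>p<n. \<Sum>q<n. (a * e i p + b * e j p) * (f (p, q) * (a * e i q + b * e j q))) =
        (\<Sum>p<n. (\<Sum>q<n. f (p, q) * (a * e i q + b * e j q)) * (a * e i p + b * e j p))"
      by (simp add: sum_distrib_left mult.commute)
    also have "\<dots> = a * (a * f (i, i) + b * f (i, j)) + b * (a * f (j, i) + b * f (j, j))"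
      by (simp only: inner)
    finally show ?thesis by (simp add: algebra_simps)
  qed
  have diag: "f (p, p) \<le> 1" if "p < n" for p
  proof -
    have "(\<Sum>i<n. \<Sum>j<n. e p i * (f (i, j) * e p j)) = f (p, p)"
      using that by (simp add: e_def if_distrib[of "\<lambda>x. _ * x"] if_distrib[of "\<lambda>x. x * _"]
          sum.delta cong: if_cong)
    moreover have "(\<Sum>i<n. e p i * e p i) = 1"
      using that by (simp add: e_def if_distrib[of "\<lambda>x. _ * x"] sum.delta cong: if_cong)
    ultimately show ?thesis using F(3)[of "e p"] by simp
  qed
  show ?thesis
    using F(2)[of "\<lambda>p. 1 * e i p + 1 * e j p"] F(2)[of "\<lambda>p. 1 * e i p + (-1) * e j p"]
      diag[OF assms(2)] diag[OF assms(3)] F(1)[OF assms(2,3)]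
    unfolding ex by simp
qed

lemma theta_feasible_nonempty:
  assumes "simple_graph n E" "1 \<le> k" "k \<le> n"
  shows "mat n n (\<lambda>(i, j). if i = j then real k / real n else 0) \<in> theta_feasible n E k"
proof -
  have loop: "{i, i} \<notin> E" for i
    using assms(1) by (auto simp: simple_graph_def dest!: bspec)
  have q: "(\<Sum>i<n. \<Sum>j<n. v i * ((if i = j then real k / real n else 0) * v j)) =
      real k / real n * (\<Sum>i<n. v i * v i)" for v :: "nat \<Rightarrow> real"
    by (simp add: sum_distrib_left if_distrib[of "\<lambda>x. _ * x"] if_distrib[of "\<lambda>x. x * _"]
        sum.delta mult_ac cong: if_cong)
  have s: "0 \<le> (\<Sum>i<n. v i * v i)" for v :: "nat \<Rightarrow> real"
    by (intro sum_nonneg) simp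
  have "real k / real n \<le> 1" using assms by simp
  then have "real k / real n * (\<Sum>i<n. v i * v i) \<le> (\<Sum>i<n. v i * v i)" for v :: "nat \<Rightarrow> real"
    using mult_right_mono[OF _ s[of v], of "real k / real n" 1] by simp
  then show ?thesis
    unfolding theta_feasible_mat_iff using assms loop s by (auto simp: q)
qed

lemma compact_box: "compact {f :: 'a \<Rightarrow> real. \<forall>p. f p \<in> {-1..1}}"
proof -
  have "compactin (product_topology (\<lambda>_::'a. euclidean) UNIV) (PiE UNIV (\<lambda>_. {-1..1::real}))"
    by (subst compactin_PiE) auto
  then show ?thesis
    by (simp add: euclidean_product_topology PiE_UNIV_domain Pi_def)
qed

theorem vartheta_attained:
  assumes "simple_graph n E" "1 \<le> k" "k \<le> n" "w \<in> carrier_vec n"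
  obtains X where "X \<in> theta_feasible n E k"
    and "vartheta n E k w = trace_inner (weight_mat w) X"
    and "\<And>Y. Y \<in> theta_feasible n E k \<Longrightarrow> trace_inner (weight_mat w) Y \<le> vartheta n E k w"
proof -
  define S where "S = {f. \<forall>p. f p \<in> {-1..1}} \<inter> {f. mat n n f \<in> theta_feasible n E k}"
  define g where "g f = (\<Sum>i<n. \<Sum>j<n. weight_mat w $$ (i, j) * f (j, i))"
    for f :: "nat \<times> nat \<Rightarrow> real"
  have W: "weight_mat w \<in> carrier_mat n n"
    using assms(4) by (auto simp: weight_mat_def)
  have g: "trace_inner (weight_mat w) (mat n n f) = g f" for f
    unfolding g_def by (rule trace_inner_mat[OF W])
  have coord: "continuous_on A (\<lambda>f :: nat \<times> nat \<Rightarrow> real. f p)" for A p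
    by (rule continuous_on_subset[OF continuous_on_product_coordinates]) simp
  have "closed {f. mat n n f \<in> theta_feasible n E k}"
    unfolding theta_feasible_mat_iff
    by (intro closed_Collect_conj closed_Collect_all closed_Collect_imp open_Collect_const
        closed_Collect_eq closed_Collect_le continuous_intros coord)
  then have comp: "compact S"
    unfolding S_def by (intro compact_Int_closed compact_box)
  have restr: "\<exists>f\<in>S. Y = mat n n f" if Y: "Y \<in> theta_feasible n E k" for Y
  proof -
    define f where "f = (\<lambda>(i, j). if i < n \<and> j < n then Y $$ (i, j) else 0)"
    have "Y \<in> carrier_mat n n" using Y by (auto simp: theta_feasible_def)
    then have eq: "Y = mat n n f" by (auto simp: f_def)
    have "f p \<in> {-1..1}" for p
    proof (cases "fst p < n \<and> snd p < n")
      case True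
      then show ?thesis
        using theta_feasible_entry_bound[of n f E k "fst p" "snd p"] Y eq by auto
    next
      case False
      then show ?thesis by (auto simp: f_def split: prod.splits)
    qed
    then show ?thesis using eq Y by (auto simp: S_def)
  qed
  have "S \<noteq> {}"
    using restr[OF theta_feasible_nonempty[OF assms(1-3)]] by blast
  moreover have "continuous_on S g"
    unfolding g_def by (intro continuous_intros coord)
  ultimately obtain f where f: "f \<in> S" "\<And>h. h \<in> S \<Longrightarrow> g h \<le> g f"
    using continuous_attains_sup[OF comp] by blast
  have feas: "mat n n f \<in> theta_feasible n E k" using f(1) by (simp add: S_def)
  have ub: "trace_inner (weight_mat w) Y \<le> g f" if "Y \<in> theta_feasible n E k" for Y
    using restr[OF that] f(2) g by auto
  have "vartheta n E k w = g f"
    unfolding vartheta_def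
    by (rule Greatest_equality) (use feas g ub in \<open>auto intro!: bexI[of _ "mat n n f"]\<close>)
  then show ?thesis using that[OF feas] g ub by simp
qed

end

theory Submission
  imports Defs
begin

text \<open>
  Every feasible \<open>X\<close> satisfies \<open>X \<preceq> I\<close> and \<open>\<langle>I, X\<rangle> = k\<close>. The first condition alone gives
  \<open>\<langle>W, X\<rangle> \<le> \<langle>W, I\<rangle>\<close>, so \<open>\<vartheta>\<^sub>k(G, w)\<close> is at most the total weight. Without it the problem is
  \<open>k\<close> times the one for \<open>k = 1\<close>, so \<open>\<vartheta>\<^sub>k(G, w) \<le> k \<vartheta>\<^sub>1(G, w)\<close>. Both bounds are sublinear in \<open>w\<close>,
  but \<open>\<vartheta>\<^sub>k\<close> itself lies strictly below both where the two conditions compete. The example adds a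
  weight attaining the second bound to one attaining the first; between them \<open>\<vartheta>\<^sub>k\<close> is strictly
  concave.

  To see where this happens, let \<open>H\<close> be an edge \<open>ab\<close> together with an isolated vertex \<open>c\<close>, and allow
  the trace \<open>3/2\<close>. For weights \<open>(1, 1, t)\<close> on \<open>(a, b, c)\<close> with \<open>1/2 \<le> t \<le> 2\<close> the maximum is
  \<open>1 + t/2 + \<surd>(2t)\<close>, which
  is strictly concave in \<open>t\<close>; at \<open>t = 1/2\<close> it equals \<open>3/2\<close> times the maximum for trace \<open>1\<close>, and at
  \<open>t = 2\<close> it equals the total weight. The complete join of two copies of \<open>H\<close> with equal
  weights and \<open>k = 3\<close> splits the trace evenly and so doubles these values. The weights
  \<open>w = (2, 2, 1)\<close> and \<open>z = (1, 1, 2)\<close> on each copy are multiples of the two end points, and \<open>w + z\<close> is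
  constant. Then
  \<open>\<vartheta>\<^sub>3(w) \<le> 3 \<cdot> 3 = 9\<close> and \<open>\<vartheta>\<^sub>3(z) \<le> 8\<close>, while \<open>\<vartheta>\<^sub>3(w + z) \<ge> 9 + 6\<surd>2 > 17\<close>.
  The three estimates follow from \<open>vartheta_le_dual\<close>, \<open>vartheta_le_total_weight\<close> and the
  feasibility of an explicit matrix, \<open>join_matrix_feasible\<close>.
\<close>

lemma trace_inner_weight_mat:
  assumes "w \<in> carrier_vec n"
  shows "trace_inner (weight_mat w) (mat n n f) =
    (\<Sum>i<n. \<Sum>j<n. sqrt (w $ i) * sqrt (w $ j) * f (j, i))"
proof -
  have "weight_mat w \<in> carrier_mat n n"
    using assms by (auto simp: weight_mat_def)
  then show ?thesis
    using assms by (auto simp: trace_inner_mat weight_mat_def intro!: sum.cong)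
qed

lemma vartheta_leI:
  assumes "simple_graph n E" "1 \<le> k" "k \<le> n" "w \<in> carrier_vec n"
    and bound: "\<And>f. mat n n f \<in> theta_feasible n E k \<Longrightarrow>
      (\<Sum>i<n. \<Sum>j<n. sqrt (w $ i) * sqrt (w $ j) * f (i, j)) \<le> c"
  shows "vartheta n E k w \<le> c"
proof -
  obtain X where X: "X \<in> theta_feasible n E k"
    "vartheta n E k w = trace_inner (weight_mat w) X"
    using vartheta_attained[OF assms(1-4)] by blast
  define f where "f = (\<lambda>p. X $$ p)"
  have eq: "X = mat n n f"
    using X(1) by (intro eq_matI) (auto simp: theta_feasible_def f_def)
  have feas: "mat n n f \<in> theta_feasible n E k"
    using X(1) eq by simp
  then have sym: "f (j, i) = f (i, j)" if "i < n" "j < n" for i j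
    using that unfolding theta_feasible_mat_iff by blast
  have "vartheta n E k w = (\<Sum>i<n. \<Sum>j<n. sqrt (w $ i) * sqrt (w $ j) * f (j, i))"
    using X(2) assms(4) by (simp add: eq trace_inner_weight_mat)
  also have "\<dots> = (\<Sum>i<n. \<Sum>j<n. sqrt (w $ i) * sqrt (w $ j) * f (i, j))"
    by (intro sum.cong refl) (simp add: sym)
  finally show ?thesis
    using bound[OF feas] by simp
qed

lemma vartheta_ge_feasible:
  assumes "simple_graph n E" "1 \<le> k" "k \<le> n" "w \<in> carrier_vec n"
    and "mat n n f \<in> theta_feasible n E k"
  shows "(\<Sum>i<n. \<Sum>j<n. sqrt (w $ i) * sqrt (w $ j) * f (j, i)) \<le> vartheta n E k w"
proof -
  have "trace_inner (weight_mat w) (mat n n f) \<le> vartheta n E k w"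
    using vartheta_attained[OF assms(1-4)] assms(5) by metis
  then show ?thesis
    using assms(4) by (simp add: trace_inner_weight_mat)
qed

text \<open>Since \<open>X \<preceq> I\<close>, the quadratic form of \<open>X\<close> at \<open>\<surd>w\<close>, which is \<open>\<langle>W, X\<rangle>\<close>, is at most \<open>\<parallel>\<surd>w\<parallel>\<^sup>2\<close>.\<close>

lemma vartheta_le_total_weight:
  assumes "simple_graph n E" "1 \<le> k" "k \<le> n" "w \<in> carrier_vec n"
    and nonneg: "\<And>i. i < n \<Longrightarrow> 0 \<le> w $ i"
  shows "vartheta n E k w \<le> (\<Sum>i<n. w $ i)"
proof (rule vartheta_leI[OF assms(1-4)])
  fix f assume "mat n n f \<in> theta_feasible n E k"
  then have "(\<Sum>i<n. \<Sum>j<n. v i * (f (i, j) * v j)) \<le> (\<Sum>i<n. v i * v i)" for v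
    unfolding theta_feasible_mat_iff by blast
  from this[of "\<lambda>i. sqrt (w $ i)"]
  have "(\<Sum>i<n. \<Sum>j<n. sqrt (w $ i) * (f (i, j) * sqrt (w $ j)))
      \<le> (\<Sum>i<n. sqrt (w $ i) * sqrt (w $ i))" .
  also have "\<dots> = (\<Sum>i<n. w $ i)"
    using nonneg by (intro sum.cong) auto
  finally show "(\<Sum>i<n. \<Sum>j<n. sqrt (w $ i) * sqrt (w $ j) * f (i, j)) \<le> (\<Sum>i<n. w $ i)"
    by (simp add: mult_ac)
qed

text \<open>
  Weak duality. A feasible \<open>X\<close> vanishes on the edges, so \<open>\<langle>\<mu>I - W, X\<rangle>\<close> is unchanged when the entries
  of \<open>\<mu>I - W\<close> on the edges are altered. If some such alteration is a Gram matrix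
  \<open>\<Sum>\<^sub>l u\<^sub>l u\<^sub>l\<^sup>T\<close>, the inner product is \<open>\<Sum>\<^sub>l u\<^sub>l\<^sup>T X u\<^sub>l \<ge> 0\<close>, whereas \<open>\<langle>\<mu>I, X\<rangle> = k \<mu>\<close>.
\<close>

lemma vartheta_le_dual:
  fixes u :: "'l \<Rightarrow> nat \<Rightarrow> real"
  assumes "simple_graph n E" "1 \<le> k" "k \<le> n" "w \<in> carrier_vec n"
    and gram: "\<And>i j. i < n \<Longrightarrow> j < n \<Longrightarrow> {i, j} \<notin> E \<Longrightarrow>
      (\<Sum>l\<in>L. u l i * u l j) = (if i = j then \<mu> else 0) - sqrt (w $ i) * sqrt (w $ j)"
  shows "vartheta n E k w \<le> real k * \<mu>"
proof (rule vartheta_leI[OF assms(1-4)])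
  fix f assume feas: "mat n n f \<in> theta_feasible n E k"
  have edge: "f (i, j) = 0" if "i < n" "j < n" "{i, j} \<in> E" for i j
    using feas that unfolding theta_feasible_mat_iff by blast
  have pos: "0 \<le> (\<Sum>i<n. \<Sum>j<n. v i * (f (i, j) * v j))" for v
    using feas unfolding theta_feasible_mat_iff by blast
  have tr: "(\<Sum>i<n. f (i, i)) = real k"
    using feas unfolding theta_feasible_mat_iff by blast
  have "0 \<le> (\<Sum>l\<in>L. \<Sum>i<n. \<Sum>j<n. u l i * (f (i, j) * u l j))"
    by (intro sum_nonneg pos)
  also have "\<dots> = (\<Sum>i<n. \<Sum>j<n. \<Sum>l\<in>L. u l i * (f (i, j) * u l j))"
    by (subst sum.swap, intro sum.cong refl, rule sum.swap)
  also have "\<dots> = (\<Sum>i<n. \<Sum>j<n. (\<Sum>l\<in>L. u l i * u l j) * f (i, j))"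
    unfolding sum_distrib_right by (intro sum.cong refl) (simp add: mult_ac)
  also have "\<dots> = (\<Sum>i<n. \<Sum>j<n. (if i = j then \<mu> * f (i, j) else 0)
      - sqrt (w $ i) * sqrt (w $ j) * f (i, j))"
  proof (intro sum.cong refl)
    fix i j assume "i \<in> {..<n}" "j \<in> {..<n}"
    then show "(\<Sum>l\<in>L. u l i * u l j) * f (i, j) =
        (if i = j then \<mu> * f (i, j) else 0) - sqrt (w $ i) * sqrt (w $ j) * f (i, j)"
      using edge[of i j] gram[of i j] by (cases "{i, j} \<in> E") (auto simp: left_diff_distrib)
  qed
  also have "\<dots> = (\<Sum>i<n. \<mu> * f (i, i))
      - (\<Sum>i<n. \<Sum>j<n. sqrt (w $ i) * sqrt (w $ j) * f (i, j))"
    by (simp add: sum_subtractf)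
  also have "(\<Sum>i<n. \<mu> * f (i, i)) = real k * \<mu>"
    by (simp add: tr flip: sum_distrib_left)
  finally show "(\<Sum>i<n. \<Sum>j<n. sqrt (w $ i) * sqrt (w $ j) * f (i, j)) \<le> real k * \<mu>"
    by simp
qed

text \<open>
  The complete join of two copies of an edge plus an isolated vertex: the copies live on
  \<open>{0, 1, 2}\<close> and \<open>{3, 4, 5}\<close>, where \<open>i div 3\<close> numbers the copy, with isolated vertices \<open>2\<close> and \<open>5\<close>.
\<close>

definition join_edges :: "nat set set" where
  "join_edges = {{i, j} | i j. i < 6 \<and> j < 6 \<and> i \<noteq> j \<and>
     \<not> (i div 3 = j div 3 \<and> (i mod 3 = 2 \<or> j mod 3 = 2))}"

lemma simple_graph_join_edges: "simple_graph 6 join_edges"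
  by (auto simp: simple_graph_def join_edges_def)

lemma join_edges_iff:
  assumes "i < 6" "j < 6"
  shows "{i, j} \<in> join_edges \<longleftrightarrow>
    i \<noteq> j \<and> \<not> (i div 3 = j div 3 \<and> (i mod 3 = 2 \<or> j mod 3 = 2))"
  using assms unfolding join_edges_def by (auto simp: doubleton_eq_iff)

lemma less_6_cases:
  assumes "i < (6 :: nat)"
  obtains "i = 0" | "i = 1" | "i = 2" | "i = 3" | "i = 4" | "i = 5"
  using assms by linarith

lemma sum_lessThan_6: "(\<Sum>i<(6 :: nat). g i) = g 0 + g 1 + g 2 + g 3 + g 4 + (g 5 :: real)"
  by (simp add: eval_nat_numeral)

text \<open>
  The optimal solution for constant weights. On each block its eigenvalues are \<open>1\<close>, \<open>1/2\<close> and \<open>0\<close>,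
  with eigenvectors \<open>(1, 1, \<surd>2)\<close>, \<open>(1, -1, 0)\<close> and \<open>(1, 1, -\<surd>2)\<close>.
\<close>

definition join_matrix :: "nat \<times> nat \<Rightarrow> real" where
  "join_matrix = (\<lambda>(i, j). if i = j then 1 / 2 else if {i, j} \<in> join_edges then 0 else sqrt 2 / 4)"

lemma sqrt_2_mult_self: "sqrt 2 * (sqrt 2 * x) = 2 * x"
  using mult.assoc[of "sqrt 2" "sqrt 2" x] by simp

lemma join_matrix_quad_form:
  "(\<Sum>i<6. \<Sum>j<6. v i * (join_matrix (i, j) * v j)) =
    ((v 0 + v 1 + sqrt 2 * v 2)\<^sup>2 + (v 0 - v 1)\<^sup>2 +
     (v 3 + v 4 + sqrt 2 * v 5)\<^sup>2 + (v 3 - v 4)\<^sup>2) / 4"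
  by (simp add: sum_lessThan_6 join_matrix_def join_edges_iff power2_eq_square algebra_simps
      sqrt_2_mult_self)

lemma join_matrix_feasible: "mat 6 6 join_matrix \<in> theta_feasible 6 join_edges 3"
  unfolding theta_feasible_mat_iff
proof (intro conjI allI impI)
  show "join_matrix (i, j) = join_matrix (j, i)" for i j
    by (simp add: join_matrix_def insert_commute)
  show "(\<Sum>i<6. join_matrix (i, i)) = real 3"
    by (simp add: join_matrix_def)
  show "join_matrix (i, j) = 0" if "i < 6" "j < 6" "{i, j} \<in> join_edges" for i j
    using that join_edges_iff[of i j] by (auto simp: join_matrix_def)
  show "0 \<le> (\<Sum>i<6. \<Sum>j<6. v i * (join_matrix (i, j) * v j))" for v
    by (simp add: join_matrix_quad_form)
  show "(\<Sum>i<6. \<Sum>j<6. v i * (join_matrix (i, j) * v j)) \<le> (\<Sum>i<6. v i * v i)" for v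
  proof -
    \<comment> \<open>Changing the signs of the off-diagonal entries of \<open>X\<close> gives \<open>I - X\<close>.\<close>
    have "(\<Sum>i<6. v i * v i) - (\<Sum>i<6. \<Sum>j<6. v i * (join_matrix (i, j) * v j)) =
        ((v 0 + v 1 - sqrt 2 * v 2)\<^sup>2 + (v 0 - v 1)\<^sup>2 +
         (v 3 + v 4 - sqrt 2 * v 5)\<^sup>2 + (v 3 - v 4)\<^sup>2) / 4"
      unfolding join_matrix_quad_form
      by (simp add: sum_lessThan_6 power2_eq_square field_simps sqrt_2_mult_self)
    also have "\<dots> \<ge> 0"
      by simp
    finally show ?thesis
      by simp
  qed
qed

theorem proposition15:
  shows "\<exists>(n :: nat) (E :: nat set set) (k :: nat) (w :: nat vec) (z :: nat vec).
    simple_graph n E \<and> 1 < k \<and> k \<le> n \<and> w \<in> carrier_vec n \<and> z \<in> carrier_vec n \<and>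
    vartheta n E k (map_vec real (w + z)) >
      vartheta n E k (map_vec real w) + vartheta n E k (map_vec real z)"
proof -
  define w where "w = vec 6 (\<lambda>i. if i mod 3 = 2 then 1 else 2 :: nat)"
  define z where "z = vec 6 (\<lambda>i. if i mod 3 = 2 then 2 else 1 :: nat)"
  have carrier: "w \<in> carrier_vec 6" "z \<in> carrier_vec 6"
    by (auto simp: w_def z_def)
  have "vartheta 6 join_edges 3 (map_vec real w) \<le> real 3 * 3"
  proof (rule vartheta_le_dual[where L = "{0, 1 :: nat}" and u = "\<lambda>l i.
      if i div 3 = l then if i mod 3 = 2 then - sqrt 2 else 1 else 0"])
    \<comment> \<open>On a block, \<open>3I - W\<close> and \<open>u u\<^sup>T\<close> with \<open>u = (1, 1, -\<surd>2)\<close> differ only at the edge.\<close>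
    fix i j :: nat assume "i < 6" "j < 6" "{i, j} \<notin> join_edges"
    then show "(\<Sum>l\<in>{0, 1 :: nat}.
        (if i div 3 = l then if i mod 3 = 2 then - sqrt 2 else 1 else 0) *
        (if j div 3 = l then if j mod 3 = 2 then - sqrt 2 else 1 else 0)) =
      (if i = j then 3 else 0) - sqrt (map_vec real w $ i) * sqrt (map_vec real w $ j)"
      by (elim less_6_cases) (simp_all add: w_def join_edges_iff)
  qed (use simple_graph_join_edges carrier in auto)
  moreover have "vartheta 6 join_edges 3 (map_vec real z) \<le> (\<Sum>i<6. map_vec real z $ i)"
    using simple_graph_join_edges carrier by (intro vartheta_le_total_weight) auto
  moreover have "(\<Sum>i<6. map_vec real z $ i) = 8"
    by (simp add: sum_lessThan_6 z_def)
  moreover have "9 + 6 * sqrt 2 \<le> vartheta 6 join_edges 3 (map_vec real (w + z))"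
  proof -
    have "map_vec real (w + z) $ i = 3" if "i < 6" for i
      using that by (simp add: w_def z_def)
    then have "(\<Sum>i<6. \<Sum>j<6. sqrt (map_vec real (w + z) $ i) * sqrt (map_vec real (w + z) $ j) *
        join_matrix (j, i)) = 9 + 6 * sqrt 2"
      by (simp add: sum_lessThan_6 join_matrix_def join_edges_iff)
    then show ?thesis
      using vartheta_ge_feasible[OF simple_graph_join_edges _ _ _ join_matrix_feasible,
          of "map_vec real (w + z)"] carrier by auto
  qed
  moreover have "4 / 3 < sqrt 2"
    by (rule real_less_rsqrt) (simp add: power2_eq_square)
  ultimately have "vartheta 6 join_edges 3 (map_vec real w) +
      vartheta 6 join_edges 3 (map_vec real z) < vartheta 6 join_edges 3 (map_vec real (w + z))"
    by simp
  then show ?thesis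
    using simple_graph_join_edges carrier
    by (intro exI[of _ "6 :: nat"] exI[of _ join_edges] exI[of _ "3 :: nat"] exI[of _ w] exI[of _ z]) auto
qed

end
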